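(* Let $X$ be a normed space, let $0<p<+\infty$, and let $\sum_i f_i$ be a series in $X^*$. Consider the following statements: (1) $\sum_i f_i$ is a weakly unconditionally Cauchy series in $X^*$. (2) $S_{w^*-\mathrm{w}_p}\left(\sum_i f_i\right)=\ell_\infty$. (3) If $x\in X$ and $M\subset\mathbb{N}$, then $\sum_{i\in M}f_i(x)$ is $\mathrm{w}_p$ convergent. Then $(1)\Rightarrow(2)\Rightarrow(3)$, and if $X$ is barrelled, then $(3)\Rightarrow(1)$.
   Context: A scalar sequence $(t_k)_k$ is strongly $p$-Cesàro summable (equivalently, $\mathrm{w}_p$ summable or $\mathrm{w}_p$ convergent) to a scalar $t$ if $\lim_n\frac1n\sum_{k=1}^n|t_k-t|^p=0$; it is $\mathrm{w}_p$ convergent if this holds for some $t$. A scalar series is $\mathrm{w}_p$ convergent if its sequence of partial sums is. For $M\subset\mathbb{N}$, $\sum_{i\in M}f_i(x)$ denotes the series $\sum_i \chi_M(i) f_i(x)$, with partial sums $\sum_{i\leq k,\, i\in M} f_i(x)$. A sequence $(g_k)_k$ in $X^*$ is weak$^*$ $\mathrm{w}_p$-summable (written $w^*-\mathrm{w}_p$ summable) to $g\in X^*$ if for every $x\in X$, $\lim_n\frac1n\sum_{k=1}^n|g_k(x)-g(x)|^p=0$; it is $w^*-\mathrm{w}_p$ summable if this holds for some $g\in X^*$. A series in $X^*$ is $w^*-\mathrm{w}_p$ summable if its sequence of partial sums is. For a series $\sum_i f_i$ in $X^*$, $$S_{w^*-\mathrm{w}_p}\left(\sum_i f_i\right)=\left\{(a_i)_i\in\ell_\infty:\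 \sum_i a_i f_i \text{ is } w^*-\mathrm{w}_p \text{ summable}\right\},$$ endowed with the supremum norm, where $\ell_\infty$ is the space of bounded scalar sequences. A series $\sum_i f_i$ in $X^*$ is weakly unconditionally Cauchy (wuc) if $\sum_{i=1}^\infty|F(f_i)|<\infty$ for every $F\in X^{**}$. *)

theory Defs
  imports "HOL-Analysis.Analysis"
begin

text \<open>
  The sort \<open>{real_normed_field, euclidean_space}\<close> of the scalars contains \<open>real\<close> and \<open>complex\<close>,
  and (up to isomorphism, by the theorem of Frobenius) nothing else. Since the libraries have
  no class of complex normed spaces, the multiplication by scalars is a parameter \<open>smul\<close>, and the
  class \<open>real_normed_vector\<close> gives the norm and the underlying real structure.
\<close>

locale normed_space_over = vector_space smul
  for smul :: "'k::{real_normed_field, euclidean_space} \<Rightarrow> 'a::real_normed_vector \<Rightarrow> 'a" +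
  assumes scale_of_real: "smul (of_real r) x = r *\<^sub>R x"
    and norm_scale: "norm (smul c x) = norm c * norm x"

lemma normed_space_over_scaleR:
  "normed_space_over (scaleR :: real \<Rightarrow> 'a::real_normed_vector \<Rightarrow> 'a)"
  by unfold_locales (auto simp: algebra_simps)

lemma normed_space_over_mult:
  "normed_space_over ((*) :: 'k::{real_normed_field, euclidean_space} \<Rightarrow> 'k \<Rightarrow> 'k)"
  by unfold_locales (auto simp: algebra_simps norm_mult scaleR_conv_of_real)

definition barrel ::
  "('k::{real_normed_field, euclidean_space} \<Rightarrow> 'a::real_normed_vector \<Rightarrow> 'a) \<Rightarrow> 'a set \<Rightarrow> bool"
  where "barrel smul B \<longleftrightarrow> closed B \<and> convex B \<and>
    (\<forall>c. \<forall>x\<in>B. norm c \<le> 1 \<longrightarrow> smul c x \<in> B) \<and>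
    (\<forall>x. \<exists>r>0. \<forall>c. norm c \<le> r \<longrightarrow> smul c x \<in> B)"

definition barrelled ::
  "('k::{real_normed_field, euclidean_space} \<Rightarrow> 'a::real_normed_vector \<Rightarrow> 'a) \<Rightarrow> bool"
  where "barrelled smul \<longleftrightarrow> (\<forall>B. barrel smul B \<longrightarrow> 0 \<in> interior B)"

text \<open>
  Elements of \<open>'a \<Rightarrow>\<^sub>L 'k\<close> are only required to be linear over the reals; \<open>X\<^sup>*\<close> is the subspace of
  those that are linear over \<open>'k\<close>, with the operator norm. Elements of the bidual are functions
  of which only the values on \<open>X\<^sup>*\<close> are relevant.
\<close>

definition dual_space ::
  "('k::{real_normed_field, euclidean_space} \<Rightarrow> 'a::real_normed_vector \<Rightarrow> 'a) \<Rightarrow> ('a \<Rightarrow>\<^sub>L 'k) set"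
  where "dual_space smul = {g. \<forall>c x. blinfun_apply g (smul c x) = c * blinfun_apply g x}"

definition scale_dual ::
  "'k::{real_normed_field, euclidean_space} \<Rightarrow> ('a::real_normed_vector \<Rightarrow>\<^sub>L 'k) \<Rightarrow> ('a \<Rightarrow>\<^sub>L 'k)"
  where "scale_dual c g = blinfun_mult_right c o\<^sub>L g"

lemma scale_dual_apply: "blinfun_apply (scale_dual c g) x = c * blinfun_apply g x"
  by (simp add: scale_dual_def)

definition bidual_space ::
  "('k::{real_normed_field, euclidean_space} \<Rightarrow> 'a::real_normed_vector \<Rightarrow> 'a)
    \<Rightarrow> (('a \<Rightarrow>\<^sub>L 'k) \<Rightarrow> 'k) set"
  where "bidual_space smul = {F.
    (\<forall>g\<in>dual_space smul. \<forall>h\<in>dual_space smul. F (g + h) = F g + F h) \<and>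
    (\<forall>c. \<forall>g\<in>dual_space smul. F (scale_dual c g) = c * F g) \<and>
    (\<exists>C. \<forall>g\<in>dual_space smul. norm (F g) \<le> C * norm g)}"

definition wuc ::
  "('k::{real_normed_field, euclidean_space} \<Rightarrow> 'a::real_normed_vector \<Rightarrow> 'a)
    \<Rightarrow> (nat \<Rightarrow> 'a \<Rightarrow>\<^sub>L 'k) \<Rightarrow> bool"
  where "wuc smul f \<longleftrightarrow> (\<forall>F\<in>bidual_space smul. summable (\<lambda>i. norm (F (f i))))"

text \<open>
  Sequences are indexed from 0, so the Cesaro mean over the first \<open>n\<close> terms runs over \<open>k < n\<close>, and
  the \<open>k\<close>-th partial sum of a series runs over \<open>i \<le> k\<close>.
\<close>

definition wp_summable_to :: "real \<Rightarrow> (nat \<Rightarrow> 'k::real_normed_vector) \<Rightarrow> 'k \<Rightarrow> bool"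
  where "wp_summable_to p t l \<longleftrightarrow>
    (\<lambda>n. (1 / real n) * (\<Sum>k<n. norm (t k - l) powr p)) \<longlonglongrightarrow> 0"

definition wp_convergent :: "real \<Rightarrow> (nat \<Rightarrow> 'k::real_normed_vector) \<Rightarrow> bool"
  where "wp_convergent p t \<longleftrightarrow> (\<exists>l. wp_summable_to p t l)"

definition wp_convergent_series :: "real \<Rightarrow> (nat \<Rightarrow> 'k::real_normed_vector) \<Rightarrow> bool"
  where "wp_convergent_series p u \<longleftrightarrow> wp_convergent p (\<lambda>k. \<Sum>i\<le>k. u i)"

definition wstar_wp_summable ::
  "('k::{real_normed_field, euclidean_space} \<Rightarrow> 'a::real_normed_vector \<Rightarrow> 'a)
    \<Rightarrow> real \<Rightarrow> (nat \<Rightarrow> 'a \<Rightarrow>\<^sub>L 'k) \<Rightarrow> bool"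
  where "wstar_wp_summable smul p g \<longleftrightarrow>
    (\<exists>l\<in>dual_space smul. \<forall>x.
      wp_summable_to p (\<lambda>k. blinfun_apply (g k) x) (blinfun_apply l x))"

text \<open>
  As \<open>nat\<close> is discrete, the type \<open>nat \<Rightarrow>\<^sub>C 'k\<close> of bounded continuous functions is the space of all
  bounded sequences of scalars with the supremum norm.
\<close>

definition S_wstar_wp ::
  "('k::{real_normed_field, euclidean_space} \<Rightarrow> 'a::real_normed_vector \<Rightarrow> 'a)
    \<Rightarrow> real \<Rightarrow> (nat \<Rightarrow> 'a \<Rightarrow>\<^sub>L 'k) \<Rightarrow> (nat \<Rightarrow>\<^sub>C 'k) set"
  where "S_wstar_wp smul p f =
    {a. wstar_wp_summable smul p (\<lambda>k. \<Sum>i\<le>k. scale_dual (apply_bcontfun a i) (f i))}"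

end

theory Submission
  imports Defs
begin

text \<open>
  For \<open>(1) \<Longrightarrow> (2)\<close>, Sokal's proof of the uniform boundedness principle is run along Cauchy sequences
  of \<open>X\<close>, which need not be complete: the limit along a Cauchy sequence is an element of the bidual,
  so a wuc series has bounded partial sums for all bounded coefficients, and the pointwise sum is
  continuous. For \<open>(3) \<Longrightarrow> (1)\<close>, divergence of \<open>\<Sum>\<bar>f\<^sub>i(x)\<bar>\<close> would give a subseries with a coordinate
  increasing to infinity, which contradicts \<open>w\<^sub>p\<close> convergence; then \<open>{x. \<Sum>\<bar>f\<^sub>i(x)\<bar> \<le> 1}\<close> is a barrel,
  and a neighbourhood of 0 in it bounds \<open>\<Sum>\<epsilon>\<^sub>i f\<^sub>i\<close> in norm uniformly in the signs \<open>\<epsilon>\<^sub>i\<close>.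
\<close>

section \<open>Uniform boundedness along Cauchy sequences\<close>

text \<open>Some \<open>v\<close> has ratio \<open>norm (T v) / norm v\<close> above two thirds of
  \<open>norm T\<close>; rescaling it to length \<open>r\<close> gives \<open>u\<close>. Any factor
  below 1 could be had; 2/3 is large enough for the later balance of gains and losses.\<close>

lemma blinfun_almost_attains_norm:
  fixes T :: "'a::real_normed_vector \<Rightarrow>\<^sub>L 'b::real_normed_vector"
  assumes "0 < r"
  obtains u where "norm u \<le> r" "2 / 3 * r * norm T \<le> norm (T u)"
proof (cases "T = 0")
  case True
  then show ?thesis using that[of 0] assms by simp
next
  case False
  have "\<exists>v. 2 / 3 * norm T * norm v < norm (T v)"
  proof (rule ccontr)
    assume "\<not> ?thesis"
    then have "norm T \<le> 2 / 3 * norm T"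
      by (intro norm_blinfun_bound) (auto simp: not_less)
    with False show False by simp
  qed
  then obtain v where v: "2 / 3 * norm T * norm v < norm (T v)" by blast
  then have "v \<noteq> 0" by auto
  let ?u = "(r / norm v) *\<^sub>R v"
  have "norm ?u \<le> r" using \<open>v \<noteq> 0\<close> assms by simp
  moreover have "2 / 3 * r * norm T \<le> norm (T ?u)"
  proof -
    have "2 / 3 * r * norm T = r / norm v * (2 / 3 * norm T * norm v)"
      using \<open>v \<noteq> 0\<close> by simp
    also have "\<dots> \<le> r / norm v * norm (T v)"
      using v assms by (intro mult_left_mono) auto
    also have "\<dots> = norm (T ?u)"
      using assms by (simp add: blinfun.scaleR_right)
    finally show ?thesis .
  qed
  ultimately show ?thesis by (rule that)
qed

text \<open>The values of \<open>T\<close> at \<open>x + u\<close> and \<open>x - u\<close> differ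
  by \<open>2 *\<^sub>R T u\<close>, so at one of the two points the image is at least as large as
  that of \<open>u\<close>, wherever the centre \<open>x\<close> lies.\<close>

lemma blinfun_almost_attains_norm_cball:
  fixes T :: "'a::real_normed_vector \<Rightarrow>\<^sub>L 'b::real_normed_vector"
  assumes "0 < r"
  shows "\<exists>y. norm (y - x) \<le> r \<and> 2 / 3 * r * norm T \<le> norm (T y)"
proof -
  obtain u where u: "norm u \<le> r" "2 / 3 * r * norm T \<le> norm (T u)"
    using blinfun_almost_attains_norm[OF assms] .
  have "T (x + u) - T (x - u) = 2 *\<^sub>R T u"
    by (simp add: blinfun.add_right blinfun.diff_right scaleR_2)
  then have "2 * norm (T u) \<le> norm (T (x + u)) + norm (T (x - u))"
    by (metis norm_scaleR abs_numeral norm_triangle_ineq4)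
  then have "norm (T u) \<le> norm (T (x + u)) \<or> norm (T u) \<le> norm (T (x - u))"
    by linarith
  then show ?thesis
  proof
    assume "norm (T u) \<le> norm (T (x + u))"
    with u show ?thesis by (intro exI[of _ "x + u"]) simp
  next
    assume "norm (T u) \<le> norm (T (x - u))"
    with u show ?thesis by (intro exI[of _ "x - u"]) simp
  qed
qed

lemma norm_diff_le_of_geometric_steps:
  fixes x :: "nat \<Rightarrow> 'a::real_normed_vector"
  assumes "\<And>n. norm (x (Suc n) - x n) \<le> (1 / 3) ^ n" "m \<le> n"
  shows "norm (x n - x m) \<le> 3 / 2 * (1 / 3) ^ m"
proof -
  \<comment> \<open>This is the exact sum of the geometric steps from \<open>m\<close> to
    \<open>n\<close>; the induction needs the negative term, which is dropped afterwards.\<close>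
  have "norm (x n - x m) \<le> 3 / 2 * ((1 / 3) ^ m - (1 / 3) ^ n)"
    using assms(2)
  proof (induction n rule: dec_induct)
    case (step n)
    have "norm (x (Suc n) - x m) \<le> norm (x (Suc n) - x n) + norm (x n - x m)"
      using norm_triangle_ineq[of "x (Suc n) - x n" "x n - x m"] by simp
    with step.IH assms(1)[of n] show ?case by (simp add: algebra_simps)
  qed simp
  also have "\<dots> \<le> 3 / 2 * (1 / 3) ^ m" by simp
  finally show ?thesis .
qed

lemma Cauchy_of_geometric_steps:
  fixes x :: "nat \<Rightarrow> 'a::real_normed_vector"
  assumes "\<And>n. norm (x (Suc n) - x n) \<le> (1 / 3) ^ n"
  shows "Cauchy x"
proof (rule metric_CauchyI)
  fix e :: real assume "0 < e"
  have "(\<lambda>m. 3 * (1 / 3 :: real) ^ m) \<longlonglongrightarrow> 3 * 0"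
    by (intro tendsto_intros LIMSEQ_realpow_zero) auto
  then have "eventually (\<lambda>m. 3 * (1 / 3 :: real) ^ m < e) sequentially"
    using \<open>0 < e\<close> by (intro order_tendstoD) auto
  then obtain M where M: "3 * (1 / 3 :: real) ^ M < e"
    by (auto simp: eventually_at_top_linorder)
  have "dist (x m) (x n) < e" if "m \<ge> M" "n \<ge> M" for m n
  proof -
    have "dist (x m) (x n) \<le> norm (x m - x M) + norm (x n - x M)"
      using dist_triangle2[of "x m" "x n" "x M"] by (simp add: dist_norm)
    also have "\<dots> \<le> 3 * (1 / 3) ^ M"
      using norm_diff_le_of_geometric_steps[OF assms \<open>m \<ge> M\<close>]
        norm_diff_le_of_geometric_steps[OF assms \<open>n \<ge> M\<close>] by linarith
    finally show ?thesis using M by simp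
  qed
  then show "\<exists>M. \<forall>m\<ge>M. \<forall>n\<ge>M. dist (x m) (x n) < e" by blast
qed

text \<open>Without completeness the constructed Cauchy sequence may have no limit point at which to
  evaluate the operators. The hypothesis therefore bounds them along the sequence: \<open>C\<close>
  is common to all \<open>T\<close>, but the index from which the bound holds may depend on
  \<open>T\<close>.\<close>

lemma uniform_boundedness_along_Cauchy:
  fixes \<T> :: "('a::real_normed_vector \<Rightarrow>\<^sub>L 'b::real_normed_vector) set"
  assumes bdd: "\<And>x. Cauchy x \<Longrightarrow> \<exists>C. \<forall>T\<in>\<T>. \<forall>\<^sub>F n in sequentially. norm (blinfun_apply T (x n)) \<le> C"
  shows "bounded \<T>"
proof (rule ccontr)
  assume "\<not> bounded \<T>"
  \<comment> \<open>Step \<open>n\<close> has length at most \<open>(1 / 3) ^ n\<close> and makes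
    the image under \<open>T n\<close> at least \<open>2/3 * (1 / 3) ^ n * norm (T n)\<close>. All
    later steps together cost at most \<open>1/2 * (1 / 3) ^ n * norm (T n)\<close>. The remaining
    sixth is at least \<open>n\<close> by the choice of \<open>T n\<close>.\<close>
  then have "\<forall>n::nat. \<exists>T\<in>\<T>. 6 * real n * 3 ^ n \<le> norm T"
    unfolding bounded_iff by (meson linear)
  then obtain T where T: "\<And>n. T n \<in> \<T>" "\<And>n. 6 * real n * 3 ^ n \<le> norm (T n)"
    by metis
  let ?P = "\<lambda>n x y. norm (y - x) \<le> (1 / 3) ^ n
    \<and> 2 / 3 * (1 / 3) ^ n * norm (T n) \<le> norm (blinfun_apply (T n) y)"
  have "\<exists>y. ?P n x y" for n x
    by (rule blinfun_almost_attains_norm_cball) simp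
  then have s: "?P n x (SOME y. ?P n x y)" for n x
    by (rule someI_ex)
  define s where "s = (\<lambda>n x. SOME y. ?P n x y)"
  define x where "x = rec_nat 0 s"
  have x: "?P n (x n) (x (Suc n))" for n
    using s[where x = "x n" and n = n] unfolding x_def s_def by simp
  have steps: "norm (x (Suc n) - x n) \<le> (1 / 3) ^ n" for n
    using x[of n] by blast
  have large: "real n \<le> norm (T n (x m))" if "m > n" for m n
  proof -
    \<comment> \<open>The tail bound starts at \<open>Suc n\<close>, and 3/2 times one third is
      1/2.\<close>
    have "norm (x m - x (Suc n)) \<le> 1 / 2 * (1 / 3) ^ n"
      using norm_diff_le_of_geometric_steps[of x "Suc n" m] steps that by simp
    then have "norm (T n) * norm (x m - x (Suc n)) \<le> norm (T n) * (1 / 2 * (1 / 3) ^ n)"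
      by (rule mult_left_mono) simp
    with norm_blinfun[of "T n" "x m - x (Suc n)"]
    have "norm (T n (x m - x (Suc n))) \<le> norm (T n) * (1 / 2 * (1 / 3) ^ n)"
      by linarith
    moreover have "norm (T n (x (Suc n))) \<le> norm (T n (x m)) + norm (T n (x m - x (Suc n)))"
      using norm_triangle_ineq4[of "T n (x m)" "T n (x m - x (Suc n))"]
      by (simp add: blinfun.diff_right)
    moreover have "2 / 3 * (1 / 3) ^ n * norm (T n) \<le> norm (T n (x (Suc n)))"
      using x[of n] by blast
    ultimately have "1 / 6 * (1 / 3) ^ n * norm (T n) \<le> norm (T n (x m))"
      by (simp add: algebra_simps)
    moreover have "1 / 6 * (1 / 3) ^ n * (6 * real n * 3 ^ n) \<le> 1 / 6 * (1 / 3) ^ n * norm (T n)"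
      by (intro mult_left_mono T) simp
    ultimately show ?thesis by (simp add: power_divide)
  qed
  from bdd[OF Cauchy_of_geometric_steps[OF steps]] obtain C where
    C: "\<And>n. \<forall>\<^sub>F m in sequentially. norm (T n (x m)) \<le> C"
    using T(1) by blast
  \<comment> \<open>First the operator is fixed by \<open>n\<close>, then \<open>m\<close> is taken
    so late that both the bound \<open>C\<close> and the growth estimate apply.\<close>
  obtain n where n: "C < real n" using reals_Archimedean2 by blast
  have "\<forall>\<^sub>F m in sequentially. norm (T n (x m)) \<le> C \<and> m > n"
    by (intro eventually_conj C eventually_gt_at_top)
  then obtain m where "norm (T n (x m)) \<le> C" "m > n"
    by (auto dest: eventually_happens)
  with large[of n m] n show False by simp
qed

section \<open>Cesaro means and strong summability\<close>

lemma Cesaro_mean_tendsto_0: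
  fixes u :: "nat \<Rightarrow> real"
  assumes u: "u \<longlonglongrightarrow> 0"
  shows "(\<lambda>n. (1 / real n) * (\<Sum>k<n. u k)) \<longlonglongrightarrow> 0"
proof (rule tendstoI)
  fix e :: real assume "0 < e"
  then have "\<forall>\<^sub>F k in sequentially. \<bar>u k\<bar> < e / 2"
    using tendstoD[OF u, of "e / 2"] by (simp add: dist_norm)
  then obtain N where N: "\<And>k. k \<ge> N \<Longrightarrow> \<bar>u k\<bar> < e / 2"
    by (auto simp: eventually_at_top_linorder)
  \<comment> \<open>The head is a constant, which division by \<open>n\<close> makes small; the
    terms from \<open>N\<close> on contribute at most \<open>e / 2\<close> to the mean.\<close>
  define A where "A = (\<Sum>k<N. \<bar>u k\<bar>)"
  have "\<forall>\<^sub>F n in sequentially. A / real n < e / 2"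
    using \<open>0 < e\<close> by (intro order_tendstoD[OF lim_const_over_n]) auto
  then show "\<forall>\<^sub>F n in sequentially. dist (1 / real n * (\<Sum>k<n. u k)) 0 < e"
    using eventually_gt_at_top[of N]
  proof eventually_elim
    case (elim n)
    have "\<bar>\<Sum>k<n. u k\<bar> \<le> (\<Sum>k<n. \<bar>u k\<bar>)" by (rule sum_abs)
    also have "\<dots> = A + (\<Sum>k=N..<n. \<bar>u k\<bar>)"
      unfolding A_def lessThan_atLeast0 using elim by (simp add: sum.atLeastLessThan_concat)
    also have "(\<Sum>k=N..<n. \<bar>u k\<bar>) \<le> (\<Sum>k=N..<n. e / 2)"
      using N by (intro sum_mono) (auto intro: less_imp_le)
    also have "\<dots> \<le> real n * (e / 2)"
      using \<open>0 < e\<close> by (simp add: mult_right_mono)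
    finally have "\<bar>\<Sum>k<n. u k\<bar> \<le> A + real n * (e / 2)" by simp
    then have "\<bar>\<Sum>k<n. u k\<bar> / real n \<le> (A + real n * (e / 2)) / real n"
      by (rule divide_right_mono) simp
    also have "\<dots> = A / real n + e / 2" using elim by (simp add: add_divide_distrib)
    also have "\<dots> < e" using elim(1) by linarith
    finally show ?case by (simp add: abs_mult)
  qed
qed

lemma tendsto_imp_wp_summable_to:
  assumes "t \<longlonglongrightarrow> l" "0 < p"
  shows "wp_summable_to p t l"
  unfolding wp_summable_to_def
proof (rule Cesaro_mean_tendsto_0)
  have "(\<lambda>k. norm (t k - l)) \<longlonglongrightarrow> 0"
    using assms(1) by (simp add: LIM_zero_iff tendsto_norm_zero_iff)
  then show "(\<lambda>k. norm (t k - l) powr p) \<longlonglongrightarrow> 0"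
    using assms(2) by (intro tendsto_zero_powrI[where b = p] tendsto_const) auto
qed

text \<open>Whatever the candidate limit \<open>l\<close>, from some \<open>N\<close> on all terms
  are at distance at least 1 from it, so their powers are at least 1 and the means cannot tend to
  0.\<close>

lemma not_wp_convergent_if_norm_at_top:
  assumes t: "filterlim (\<lambda>k. norm (t k)) at_top sequentially" and "0 \<le> p"
  shows "\<not> wp_convergent p t"
proof
  assume "wp_convergent p t"
  then obtain l where "wp_summable_to p t l" by (auto simp: wp_convergent_def)
  then have lim: "(\<lambda>n. (1 / real n) * (\<Sum>k<n. norm (t k - l) powr p)) \<longlonglongrightarrow> 0"
    by (simp add: wp_summable_to_def)
  have "\<forall>\<^sub>F k in sequentially. 1 + norm l \<le> norm (t k)"
    using t by (auto simp: filterlim_at_top)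
  then obtain N where "\<And>k. k \<ge> N \<Longrightarrow> 1 + norm l \<le> norm (t k)"
    by (auto simp: eventually_at_top_linorder)
  then have N: "1 \<le> norm (t k - l)" if "k \<ge> N" for k
    using norm_triangle_ineq2[of "t k" l] that by force
  have "\<forall>\<^sub>F n in sequentially. (1 / real n) * (\<Sum>k<n. norm (t k - l) powr p) < 1 / 2"
    by (rule order_tendstoD[OF lim]) simp
  \<comment> \<open>For \<open>n > 2 * N\<close> more than half of the indices below
    \<open>n\<close> are at least \<open>N\<close>, which forces the mean to be at least
    1/2.\<close>
  then have "\<forall>\<^sub>F n in sequentially. (1 / real n) * (\<Sum>k<n. norm (t k - l) powr p) < 1 / 2
      \<and> n > 2 * N"
    by (intro eventually_conj eventually_gt_at_top)
  then obtain n where n: "(1 / real n) * (\<Sum>k<n. norm (t k - l) powr p) < 1 / 2" "n > 2 * N"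
    by (auto dest: eventually_happens)
  have "real (n - N) = (\<Sum>k=N..<n. 1)" by simp
  also have "\<dots> \<le> (\<Sum>k=N..<n. norm (t k - l) powr p)"
    using N \<open>0 \<le> p\<close> by (intro sum_mono) (simp add: ge_one_powr_ge_zero)
  also have "\<dots> \<le> (\<Sum>k<n. norm (t k - l) powr p)"
    by (rule sum_mono2) auto
  finally have "real n / 2 \<le> (\<Sum>k<n. norm (t k - l) powr p)" using n(2) by simp
  with n show False by (simp add: field_simps)
qed

section \<open>Absolute convergence from convergence of all subseries\<close>

lemma filterlim_partial_sums_at_top:
  fixes u :: "nat \<Rightarrow> real"
  assumes nonneg: "\<And>i. 0 \<le> u i" and "\<not> summable u"
  shows "filterlim (\<lambda>k. \<Sum>i\<le>k. u i) at_top sequentially"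
  unfolding filterlim_at_top
proof
  fix Z :: real
  obtain n where n: "Z < (\<Sum>i<n. u i)"
    using summableI_nonneg_bounded[OF nonneg, where x = Z] assms(2) by (meson not_less)
  show "\<forall>\<^sub>F k in sequentially. Z \<le> (\<Sum>i\<le>k. u i)"
    using eventually_ge_at_top[of n]
  proof eventually_elim
    case (elim k)
    then have "(\<Sum>i<n. u i) \<le> (\<Sum>i\<le>k. u i)"
      by (intro sum_mono2 nonneg) auto
    with n show ?case by simp
  qed
qed

text \<open>The subseries over the indices with \<open>c i \<bullet> b\<close> positive has no
  cancellation in direction \<open>b\<close>: the inner products of its partial sums with
  \<open>b\<close> are the partial sums of the positive parts. If these diverged, Cauchy-Schwarz
  would drive the norms to infinity.\<close>

lemma summable_positive_part_if_wp_convergent: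
  fixes c :: "nat \<Rightarrow> 'k::{real_normed_field, euclidean_space}"
  assumes conv: "\<And>M::nat set. wp_convergent_series p (\<lambda>i. indicator M i * c i)"
    and "0 \<le> p"
  shows "summable (\<lambda>i. max 0 (c i \<bullet> b))"
proof (rule ccontr)
  assume not_summable: "\<not> ?thesis"
  then have top: "filterlim (\<lambda>k. \<Sum>i\<le>k. max 0 (c i \<bullet> b)) at_top sequentially"
    by (intro filterlim_partial_sums_at_top) auto
  let ?M = "{i. 0 < c i \<bullet> b}"
  let ?t = "\<lambda>k. \<Sum>i\<le>k. indicator ?M i * c i"
  have "b \<noteq> 0" using not_summable by auto
  have le: "(\<Sum>i\<le>k. max 0 (c i \<bullet> b)) * inverse (norm b) \<le> norm (?t k)" for k
  proof -
    have "(\<Sum>i\<le>k. max 0 (c i \<bullet> b)) = ?t k \<bullet> b"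
      unfolding inner_sum_left by (intro sum.cong) (auto simp: indicator_def)
    also have "\<dots> \<le> norm (?t k) * norm b" by (rule norm_cauchy_schwarz)
    finally show ?thesis using \<open>b \<noteq> 0\<close> by (simp add: field_simps)
  qed
  have "filterlim (\<lambda>k. (\<Sum>i\<le>k. max 0 (c i \<bullet> b)) * inverse (norm b)) at_top sequentially"
    using \<open>b \<noteq> 0\<close> by (intro filterlim_at_top_mult_tendsto_pos[OF tendsto_const _ top]) auto
  then have "filterlim (\<lambda>k. norm (?t k)) at_top sequentially"
    by (rule filterlim_at_top_mono) (simp only: le eventually_True)
  from not_wp_convergent_if_norm_at_top[OF this \<open>0 \<le> p\<close>] conv[of ?M] show False
    by (simp add: wp_convergent_series_def)
qed

text \<open>The norm is at most the sum of the absolute coordinates, and each of these is the sum of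
  the positive parts along \<open>b\<close> and \<open>- b\<close>. This treats real and complex
  scalars alike.\<close>

lemma summable_norm_if_subseries_wp_convergent:
  fixes c :: "nat \<Rightarrow> 'k::{real_normed_field, euclidean_space}"
  assumes "\<And>M::nat set. wp_convergent_series p (\<lambda>i. indicator M i * c i)" and "0 \<le> p"
  shows "summable (\<lambda>i. norm (c i))"
proof (rule summable_comparison_test')
  show "summable (\<lambda>i. \<Sum>b\<in>Basis. max 0 (c i \<bullet> b) + max 0 (c i \<bullet> - b))"
    by (intro summable_sum summable_add summable_positive_part_if_wp_convergent[OF assms])
  show "norm (norm (c i)) \<le> (\<Sum>b\<in>Basis. max 0 (c i \<bullet> b) + max 0 (c i \<bullet> - b))" for i
  proof -
    have "norm (c i) \<le> (\<Sum>b\<in>Basis. \<bar>c i \<bullet> b\<bar>)" by (rule norm_le_l1)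
    also have "\<dots> = (\<Sum>b\<in>Basis. max 0 (c i \<bullet> b) + max 0 (c i \<bullet> - b))"
      by (intro sum.cong) (auto simp: max_def)
    finally show ?thesis by simp
  qed
qed

section \<open>Functionals on the dual space\<close>

lemma dual_space_sum:
  assumes "\<And>i. i \<in> A \<Longrightarrow> g i \<in> dual_space smul"
  shows "(\<Sum>i\<in>A. g i) \<in> dual_space smul"
  using assms by (simp add: dual_space_def blinfun.sum_left sum_distrib_left)

lemma dual_space_scale_dual:
  assumes "g \<in> dual_space smul"
  shows "scale_dual c g \<in> dual_space smul"
  using assms by (simp add: dual_space_def scale_dual_apply)

lemma bidual_space_add:
  assumes "F \<in> bidual_space smul" "g \<in> dual_space smul" "h \<in> dual_space smul"
  shows "F (g + h) = F g + F h"
  using assms by (simp add: bidual_space_def)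

lemma bidual_space_scale_dual:
  assumes "F \<in> bidual_space smul" "g \<in> dual_space smul"
  shows "F (scale_dual c g) = c * F g"
  using assms by (simp add: bidual_space_def)

lemma bidual_space_sum_scale_dual:
  fixes smul :: "'k::{real_normed_field, euclidean_space} \<Rightarrow> 'a::real_normed_vector \<Rightarrow> 'a"
  assumes F: "F \<in> bidual_space smul" and g: "\<And>i. g i \<in> dual_space smul" and "finite A"
  shows "F (\<Sum>i\<in>A. scale_dual (c i) (g i)) = (\<Sum>i\<in>A. c i * F (g i))"
  using \<open>finite A\<close>
proof (induction A)
  case empty
  \<comment> \<open>The value of \<open>F\<close> at 0 follows from homogeneity with the scalar
    0.\<close>
  have "0 \<in> dual_space smul" by (simp add: dual_space_def)
  then have "F (scale_dual 0 0) = 0" by (simp add: bidual_space_scale_dual[OF F])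
  moreover have "scale_dual 0 0 = (0 :: 'a \<Rightarrow>\<^sub>L 'k)"
    by (rule blinfun_eqI) (simp add: scale_dual_apply)
  ultimately show ?case by simp
next
  case (insert i A)
  have "(\<Sum>i\<in>A. scale_dual (c i) (g i)) \<in> dual_space smul"
    by (intro dual_space_sum dual_space_scale_dual g)
  then show ?case
    using insert by (simp add: bidual_space_add[OF F] bidual_space_scale_dual[OF F]
        dual_space_scale_dual g)
qed

lemma Cauchy_imp_blinfun_convergent:
  fixes g :: "'a::real_normed_vector \<Rightarrow>\<^sub>L 'k::euclidean_space"
  assumes "Cauchy x"
  shows "convergent (\<lambda>n. blinfun_apply g (x n))"
  using bounded_linear.Cauchy[OF blinfun.bounded_linear_right assms]
  by (rule Cauchy_convergent)

text \<open>A Cauchy sequence stands for a point of the completion, and evaluation there is a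
  functional on the dual. The limits exist because the scalars are complete, and a bound of the
  sequence bounds the functional. Constant sequences give evaluation at points of the space
  itself.\<close>

lemma bidual_space_lim_Cauchy:
  fixes x :: "nat \<Rightarrow> 'a::real_normed_vector"
    and smul :: "'k::{real_normed_field, euclidean_space} \<Rightarrow> 'a \<Rightarrow> 'a"
  assumes x: "Cauchy x"
  shows "(\<lambda>g. lim (\<lambda>n. blinfun_apply g (x n))) \<in> bidual_space smul"
proof -
  let ?F = "\<lambda>g::'a \<Rightarrow>\<^sub>L 'k. lim (\<lambda>n. blinfun_apply g (x n))"
  have F: "(\<lambda>n. blinfun_apply g (x n)) \<longlonglongrightarrow> ?F g" for g :: "'a \<Rightarrow>\<^sub>L 'k"
    using Cauchy_imp_blinfun_convergent[OF x] by (simp add: convergent_LIMSEQ_iff)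
  have "?F (g + h) = ?F g + ?F h" for g h
    by (rule limI) (auto simp: blinfun.add_left intro!: tendsto_add F)
  moreover have "?F (scale_dual c g) = c * ?F g" for c g
    by (rule limI) (auto simp: scale_dual_apply intro!: tendsto_mult_left F)
  moreover have "\<exists>C. \<forall>g\<in>dual_space smul. norm (?F g) \<le> C * norm g"
  proof -
    obtain C where C: "\<And>n. norm (x n) \<le> C"
      using cauchy_imp_bounded[OF x] by (auto simp: bounded_iff)
    have "norm (?F g) \<le> C * norm g" for g
    proof (rule LIMSEQ_le_const2[OF tendsto_norm[OF F]])
      have "norm (g (x n)) \<le> C * norm g" for n
        using norm_blinfun[of g "x n"] mult_left_mono[OF C[of n], of "norm g"]
        by (simp add: mult.commute)
      then show "\<exists>N. \<forall>n\<ge>N. norm (g (x n)) \<le> C * norm g" by blast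
    qed
    then show ?thesis by blast
  qed
  ultimately show ?thesis by (simp add: bidual_space_def)
qed

section \<open>From wuc to summability for all bounded coefficients\<close>

text \<open>With \<open>F\<close> the limit along a Cauchy sequence, \<open>A\<close> times the sum
  of all \<open>norm (F (f i))\<close> bounds \<open>F\<close> on every partial sum. This is the
  bound required by uniform boundedness along Cauchy sequences.\<close>

lemma wuc_imp_bounded_partial_sums:
  fixes smul :: "'k::{real_normed_field, euclidean_space} \<Rightarrow> 'a::real_normed_vector \<Rightarrow> 'a"
    and a :: "nat \<Rightarrow> 'k"
  assumes f: "\<And>i. f i \<in> dual_space smul" and "wuc smul f" and a: "\<And>i. norm (a i) \<le> A"
  shows "bounded (range (\<lambda>k. \<Sum>i\<le>k. scale_dual (a i) (f i)))"
proof (rule uniform_boundedness_along_Cauchy)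
  fix x :: "nat \<Rightarrow> 'a" assume x: "Cauchy x"
  define F where "F = (\<lambda>g::'a \<Rightarrow>\<^sub>L 'k. lim (\<lambda>n. blinfun_apply g (x n)))"
  have F: "F \<in> bidual_space smul"
    unfolding F_def by (rule bidual_space_lim_Cauchy[OF x])
  then have summ: "summable (\<lambda>i. norm (F (f i)))"
    using \<open>wuc smul f\<close> by (auto simp: wuc_def)
  have "0 \<le> A" using a[of 0] norm_ge_zero order_trans by blast
  define C where "C = A * (\<Sum>i. norm (F (f i)))"
  have "\<forall>\<^sub>F n in sequentially. norm ((\<Sum>i\<le>k. scale_dual (a i) (f i)) (x n)) \<le> C + 1" for k
  proof -
    let ?T = "\<Sum>i\<le>k. scale_dual (a i) (f i)"
    have "norm (F ?T) \<le> (\<Sum>i\<le>k. norm (a i) * norm (F (f i)))"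
      unfolding bidual_space_sum_scale_dual[OF F f finite_atMost]
      by (rule sum_norm_le) (simp add: norm_mult)
    also have "\<dots> \<le> A * (\<Sum>i\<le>k. norm (F (f i)))"
      unfolding sum_distrib_left by (intro sum_mono mult_right_mono a) auto
    also have "\<dots> \<le> C"
      unfolding C_def by (intro mult_left_mono sum_le_suminf summ \<open>0 \<le> A\<close>) auto
    \<comment> \<open>The margin 1 makes the inequality strict, so that it passes from the limit to
      almost all \<open>n\<close>; the bound does not depend on \<open>k\<close>.\<close>
    finally have "norm (F ?T) < C + 1" by simp
    moreover have "(\<lambda>n. blinfun_apply ?T (x n)) \<longlonglongrightarrow> F ?T"
      using Cauchy_imp_blinfun_convergent[OF x] by (simp add: F_def convergent_LIMSEQ_iff)
    ultimately have "\<forall>\<^sub>F n in sequentially. norm (?T (x n)) < C + 1"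
      by (intro order_tendstoD(2)[OF tendsto_norm])
    then show ?thesis by eventually_elim simp
  qed
  then show "\<exists>C. \<forall>T\<in>range (\<lambda>k. \<Sum>i\<le>k. scale_dual (a i) (f i)).
      \<forall>\<^sub>F n in sequentially. norm (blinfun_apply T (x n)) \<le> C"
    by blast
qed

text \<open>Linearity and the common norm bound pass to the limit. Boundedness is assumed because on
  an incomplete space it does not follow from pointwise convergence.\<close>

lemma pointwise_limit_in_dual_space:
  fixes smul :: "'k::{real_normed_field, euclidean_space} \<Rightarrow> 'a::real_normed_vector \<Rightarrow> 'a"
  assumes g: "\<And>k. g k \<in> dual_space smul" and bdd: "bounded (range g)"
    and conv: "\<And>x. convergent (\<lambda>k. blinfun_apply (g k) x)"
  obtains l where "l \<in> dual_space smul"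
    "\<And>x. (\<lambda>k. blinfun_apply (g k) x) \<longlonglongrightarrow> blinfun_apply l x"
proof -
  define h where "h = (\<lambda>x. lim (\<lambda>k. blinfun_apply (g k) x))"
  have h: "(\<lambda>k. blinfun_apply (g k) x) \<longlonglongrightarrow> h x" for x
    using conv by (simp add: h_def convergent_LIMSEQ_iff)
  obtain K where K: "\<And>k. norm (g k) \<le> K" using bdd by (auto simp: bounded_iff)
  have "bounded_linear h"
  proof (rule bounded_linear_intro)
    fix x y r
    show "h (x + y) = h x + h y"
      unfolding h_def[THEN fun_cong, of "x + y"]
      by (rule limI) (auto simp: blinfun.add_right intro!: tendsto_add h)
    show "h (r *\<^sub>R x) = r *\<^sub>R h x"
      unfolding h_def[THEN fun_cong, of "r *\<^sub>R x"]
      by (rule limI) (auto simp: blinfun.scaleR_right intro!: tendsto_scaleR h)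
    show "norm (h x) \<le> norm x * K"
    proof (rule LIMSEQ_le_const2[OF tendsto_norm[OF h]])
      have "norm (g k x) \<le> norm x * K" for k
        using norm_blinfun[of "g k" x] mult_right_mono[OF K[of k], of "norm x"]
        by (simp add: mult.commute)
      then show "\<exists>N. \<forall>k\<ge>N. norm (g k x) \<le> norm x * K" by blast
    qed
  qed
  then have l: "blinfun_apply (Blinfun h) = h" by (rule bounded_linear_Blinfun_apply)
  have "h (smul c x) = c * h x" for c x
    unfolding h_def[THEN fun_cong, of "smul c x"]
    using g by (intro limI) (auto simp: dual_space_def intro!: tendsto_mult_left h)
  then have "Blinfun h \<in> dual_space smul" by (simp add: dual_space_def l)
  with h l show ?thesis by (intro that[of "Blinfun h"]) auto
qed

lemma wuc_imp_wstar_wp_summable: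
  fixes smul :: "'k::{real_normed_field, euclidean_space} \<Rightarrow> 'a::real_normed_vector \<Rightarrow> 'a"
    and a :: "nat \<Rightarrow> 'k"
  assumes f: "\<And>i. f i \<in> dual_space smul" and "wuc smul f" and a: "\<And>i. norm (a i) \<le> A"
    and "0 < p"
  shows "wstar_wp_summable smul p (\<lambda>k. \<Sum>i\<le>k. scale_dual (a i) (f i))"
proof -
  let ?g = "\<lambda>k. \<Sum>i\<le>k. scale_dual (a i) (f i)"
  have "convergent (\<lambda>k. blinfun_apply (?g k) x)" for x
  proof -
    \<comment> \<open>The constant sequence \<open>x\<close> yields evaluation at \<open>x\<close>
      as an element of the bidual, so wuc gives absolute convergence at each point.\<close>
    have "(\<lambda>g. lim (\<lambda>n. blinfun_apply g x)) \<in> bidual_space smul"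
      by (rule bidual_space_lim_Cauchy) (simp add: convergent_Cauchy convergent_const)
    then have "summable (\<lambda>i. norm (lim (\<lambda>n::nat. blinfun_apply (f i) x)))"
      using \<open>wuc smul f\<close> by (auto simp: wuc_def)
    then have "summable (\<lambda>i. norm (blinfun_apply (f i) x))"
      by (simp add: limI)
    then have "summable (\<lambda>i. A * norm (blinfun_apply (f i) x))"
      by (rule summable_mult)
    then have "summable (\<lambda>i. a i * blinfun_apply (f i) x)"
      by (rule summable_comparison_test') (simp add: norm_mult mult_right_mono a)
    then show ?thesis
      by (simp add: summable_iff_convergent' blinfun.sum_left scale_dual_apply)
  qed
  moreover have "?g k \<in> dual_space smul" for k
    by (intro dual_space_sum dual_space_scale_dual f)
  moreover have "bounded (range ?g)"
    using f \<open>wuc smul f\<close> a by (rule wuc_imp_bounded_partial_sums)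
  ultimately obtain l where "l \<in> dual_space smul"
    "\<And>x. (\<lambda>k. blinfun_apply (?g k) x) \<longlonglongrightarrow> blinfun_apply l x"
    using pointwise_limit_in_dual_space[of ?g smul] by blast
  with \<open>0 < p\<close> show ?thesis
    unfolding wstar_wp_summable_def by (blast intro: tendsto_imp_wp_summable_to)
qed

section \<open>Subseries as multiplier series\<close>

text \<open>The indicator of \<open>M\<close> is a bounded sequence of coefficients; evaluating its
  multiplier series at \<open>x\<close> gives the subseries.\<close>

lemma S_wstar_wp_UNIV_imp_wp_convergent:
  assumes "S_wstar_wp smul p f = UNIV"
  shows "wp_convergent_series p (\<lambda>i. indicator M i * blinfun_apply (f i) x)"
proof -
  have "(indicator M :: nat \<Rightarrow> 'a) \<in> bcontfun"
    by (rule bcontfun_normI[where b = 1]) (auto simp: indicator_def)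
  then have "apply_bcontfun (Bcontfun (indicator M :: nat \<Rightarrow> 'a)) = indicator M"
    by (rule Bcontfun_inverse)
  moreover have "wstar_wp_summable smul p
      (\<lambda>k. \<Sum>i\<le>k. scale_dual (apply_bcontfun (Bcontfun (indicator M)) i) (f i))"
    using assms by (auto simp: S_wstar_wp_def)
  ultimately have "wstar_wp_summable smul p (\<lambda>k. \<Sum>i\<le>k. scale_dual (indicator M i) (f i))"
    by simp
  then show ?thesis
    by (auto simp: wstar_wp_summable_def wp_convergent_series_def wp_convergent_def
        blinfun.sum_left scale_dual_apply)
qed

section \<open>Barrels and the return to wuc\<close>

text \<open>Stating the bound for all finite sums makes the set an intersection of closed sets, each
  given by a continuous function. Summability at each point makes it absorbing.\<close>

lemma barrel_sum_norm_le_1: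
  fixes smul :: "'k::{real_normed_field, euclidean_space} \<Rightarrow> 'a::real_normed_vector \<Rightarrow> 'a"
  assumes f: "\<And>i. f i \<in> dual_space smul"
    and summ: "\<And>x. summable (\<lambda>i. norm (blinfun_apply (f i) x))"
  shows "barrel smul {x. \<forall>n. (\<Sum>i<n. norm (blinfun_apply (f i) x)) \<le> 1}" (is "barrel _ ?B")
proof -
  have scale: "(\<Sum>i<n. norm (f i (smul c x))) = norm c * (\<Sum>i<n. norm (f i x))" for n c x
    using f by (simp add: dual_space_def norm_mult sum_distrib_left)
  have "closed ?B"
    by (intro closed_Collect_all closed_Collect_le continuous_intros)
  moreover have "convex ?B"
  proof (rule convexI)
    fix x y :: 'a and u v :: real
    assume x: "x \<in> ?B" and y: "y \<in> ?B" and uv: "0 \<le> u" "0 \<le> v" "u + v = 1"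
    have "(\<Sum>i<n. norm (f i (u *\<^sub>R x + v *\<^sub>R y))) \<le> 1" for n
    proof -
      have "(\<Sum>i<n. norm (f i (u *\<^sub>R x + v *\<^sub>R y)))
          \<le> (\<Sum>i<n. u * norm (f i x) + v * norm (f i y))"
        using uv
        by (intro sum_mono)
          (auto simp: blinfun.add_right blinfun.scaleR_right intro!: norm_triangle_le)
      also have "\<dots> = u * (\<Sum>i<n. norm (f i x)) + v * (\<Sum>i<n. norm (f i y))"
        by (simp add: sum.distrib sum_distrib_left)
      also have "\<dots> \<le> u * 1 + v * 1"
        using x y uv by (intro add_mono mult_left_mono) auto
      finally show ?thesis using uv by simp
    qed
    then show "u *\<^sub>R x + v *\<^sub>R y \<in> ?B" by simp
  qed
  moreover have "smul c x \<in> ?B" if "x \<in> ?B" "norm c \<le> 1" for c x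
    using that by (auto simp: scale intro!: mult_le_one sum_nonneg)
  moreover have "\<exists>r>0. \<forall>c. norm c \<le> r \<longrightarrow> smul c x \<in> ?B" for x
  proof (intro exI conjI allI impI)
    let ?S = "\<Sum>i. norm (f i x)"
    have "0 \<le> ?S" by (intro suminf_nonneg summ) simp
    \<comment> \<open>Adding 1 covers the case that all \<open>f i\<close> vanish at
      \<open>x\<close>.\<close>
    then show "0 < 1 / (?S + 1)" by simp
    fix c :: 'k assume c: "norm c \<le> 1 / (?S + 1)"
    have "norm c * (\<Sum>i<n. norm (f i x)) \<le> 1" for n
    proof -
      have "norm c * (\<Sum>i<n. norm (f i x)) \<le> 1 / (?S + 1) * ?S"
        using \<open>0 \<le> ?S\<close> by (intro mult_mono c sum_le_suminf summ) (auto intro: sum_nonneg)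
      also have "\<dots> \<le> 1" using \<open>0 \<le> ?S\<close> by simp
      finally show ?thesis .
    qed
    then show "smul c x \<in> ?B" by (simp add: scale)
  qed
  ultimately show ?thesis by (auto simp: barrel_def)
qed

text \<open>A ball of radius \<open>r\<close> inside the barrel gives a bound \<open>1 / r\<close>
  for the norm of every finite sum of the \<open>f i\<close> with coefficients of modulus at most 1.
  Coefficients that turn each \<open>F (f i)\<close> into its modulus then bound the sums of these
  moduli.\<close>

lemma barrelled_pointwise_summable_imp_wuc:
  fixes smul :: "'k::{real_normed_field, euclidean_space} \<Rightarrow> 'a::real_normed_vector \<Rightarrow> 'a"
  assumes f: "\<And>i. f i \<in> dual_space smul" and "barrelled smul"
    and summ: "\<And>x. summable (\<lambda>i. norm (blinfun_apply (f i) x))"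
  shows "wuc smul f"
  unfolding wuc_def
proof
  fix F assume F: "F \<in> bidual_space smul"
  then have "\<exists>C. \<forall>g\<in>dual_space smul. norm (F g) \<le> C * norm g"
    by (simp add: bidual_space_def)
  then obtain C where C: "\<And>g. g \<in> dual_space smul \<Longrightarrow> norm (F g) \<le> C * norm g"
    by blast
  have "0 \<in> interior {x. \<forall>n. (\<Sum>i<n. norm (f i x)) \<le> 1}"
    using barrel_sum_norm_le_1[OF f summ] \<open>barrelled smul\<close> by (auto simp: barrelled_def)
  then obtain r where r: "0 < r" "\<And>x n. norm x \<le> r \<Longrightarrow> (\<Sum>i<n. norm (f i x)) \<le> 1"
    by (auto simp: mem_interior_cball subset_iff)
  have sum_le: "(\<Sum>i<n. norm (f i x)) \<le> 1 / r * norm x" for n x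
  proof (cases "x = 0")
    case False
    have "(\<Sum>i<n. norm (f i ((r / norm x) *\<^sub>R x))) \<le> 1"
      using r False by (intro r(2)) simp
    then have "r / norm x * (\<Sum>i<n. norm (f i x)) \<le> 1"
      using \<open>0 < r\<close> by (simp add: blinfun.scaleR_right sum_distrib_left)
    then show ?thesis using \<open>0 < r\<close> False by (simp add: field_simps)
  qed simp
  show "summable (\<lambda>i. norm (F (f i)))"
  proof (rule summableI_nonneg_bounded)
    fix n
    \<comment> \<open>the conjugate sign of \<open>F (f i)\<close>; 0 by division by zero if \<open>F (f i) = 0\<close>\<close>
    define s where "s i = of_real (norm (F (f i))) / F (f i)" for i
    have s: "norm (s i) \<le> 1" "s i * F (f i) = of_real (norm (F (f i)))" for i
      by (auto simp: s_def norm_divide)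
    let ?g = "\<Sum>i<n. scale_dual (s i) (f i)"
    have "norm ?g \<le> 1 / r"
    proof (rule norm_blinfun_bound)
      fix x
      have "norm (?g x) \<le> (\<Sum>i<n. norm (f i x))"
        unfolding blinfun.sum_left using s(1)
        by (intro sum_norm_le) (simp add: scale_dual_apply norm_mult mult_left_le_one_le)
      with sum_le[where n = n and x = x] show "norm (?g x) \<le> 1 / r * norm x" by linarith
    qed (use r in simp)
    have "F ?g = (\<Sum>i<n. s i * F (f i))"
      by (rule bidual_space_sum_scale_dual[OF F f]) simp
    also have "\<dots> = of_real (\<Sum>i<n. norm (F (f i)))" by (simp add: s)
    finally have "norm (F ?g) = \<bar>\<Sum>i<n. norm (F (f i))\<bar>" by (simp only: norm_of_real)
    then have "(\<Sum>i<n. norm (F (f i))) \<le> norm (F ?g)" by simp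
    also have "\<dots> \<le> C * norm ?g"
      by (intro C dual_space_sum dual_space_scale_dual f)
    \<comment> \<open>The sign of \<open>C\<close> is not known, hence the absolute value.\<close>
    also have "\<dots> \<le> \<bar>C\<bar> * (1 / r)"
      using \<open>norm ?g \<le> 1 / r\<close> by (intro mult_mono) auto
    finally show "(\<Sum>i<n. norm (F (f i))) \<le> \<bar>C\<bar> * (1 / r)" .
  qed simp
qed

theorem theorem5p1:
  fixes smul :: "'k::{real_normed_field, euclidean_space} \<Rightarrow> 'a::real_normed_vector \<Rightarrow> 'a"
    and p :: real
    and f :: "nat \<Rightarrow> 'a \<Rightarrow>\<^sub>L 'k"
  assumes "normed_space_over smul"
    and "0 < p"
    and "\<And>i. f i \<in> dual_space smul"
  shows "(wuc smul f \<longrightarrow> S_wstar_wp smul p f = UNIV)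
    \<and> (S_wstar_wp smul p f = UNIV \<longrightarrow>
        (\<forall>x. \<forall>M::nat set. wp_convergent_series p (\<lambda>i. indicator M i * blinfun_apply (f i) x)))
    \<and> (barrelled smul \<longrightarrow>
        (\<forall>x. \<forall>M::nat set. wp_convergent_series p (\<lambda>i. indicator M i * blinfun_apply (f i) x)) \<longrightarrow>
        wuc smul f)"
proof (intro conjI impI)
  assume "wuc smul f"
  \<comment> \<open>The supremum norm of \<open>a\<close> serves as the bound of the
    coefficients.\<close>
  have "a \<in> S_wstar_wp smul p f" for a
    unfolding S_wstar_wp_def
    using wuc_imp_wstar_wp_summable[OF assms(3) \<open>wuc smul f\<close> norm_bounded \<open>0 < p\<close>] by simp
  then show "S_wstar_wp smul p f = UNIV" by blast
next
  assume "S_wstar_wp smul p f = UNIV"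
  then show "\<forall>x. \<forall>M::nat set. wp_convergent_series p (\<lambda>i. indicator M i * blinfun_apply (f i) x)"
    by (blast intro: S_wstar_wp_UNIV_imp_wp_convergent)
next
  assume "barrelled smul"
    and "\<forall>x. \<forall>M::nat set. wp_convergent_series p (\<lambda>i. indicator M i * blinfun_apply (f i) x)"
  with assms(2,3) show "wuc smul f"
    by (intro barrelled_pointwise_summable_imp_wuc summable_norm_if_subseries_wp_convergent) auto
qed

end
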